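(* If $G$ is a finite non-abelian induced regular group, then $G/Z(G)$ is a $p$-group for some prime $p$.
   Context: For a finite group $G$, $C_G(x)$ denotes the centralizer of $x\in G$ and $Z(G)$ the center. The non-centralizer graph $\Upsilon_G$ is the simple graph with vertex set $G$ in which two distinct vertices $x,y$ are adjacent iff $C_G(x)\neq C_G(y)$; the induced non-centralizer graph $\Upsilon_{G\setminus Z(G)}$ is its induced subgraph on $G\setminus Z(G)$. $G$ is called induced regular if $\Upsilon_{G\setminus Z(G)}$ is a regular graph (all vertices have the same degree). *)

theory Defs
  imports "HOL-Algebra.Algebra"
begin

definition centralizer :: "('a, 'b) monoid_scheme \<Rightarrow> 'a \<Rightarrow> 'a set" where
  "centralizer G x = {y \<in> carrier G. x \<otimes>\<^bsub>G\<^esub> y = y \<otimes>\<^bsub>G\<^esub> x}"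

definition group_center :: "('a, 'b) monoid_scheme \<Rightarrow> 'a set" where
  "group_center G = {z \<in> carrier G. \<forall>y \<in> carrier G. z \<otimes>\<^bsub>G\<^esub> y = y \<otimes>\<^bsub>G\<^esub> z}"

definition noncentralizer_adj :: "('a, 'b) monoid_scheme \<Rightarrow> 'a \<Rightarrow> 'a \<Rightarrow> bool" where
  "noncentralizer_adj G x y \<longleftrightarrow> x \<noteq> y \<and> centralizer G x \<noteq> centralizer G y"

definition induced_nc_degree :: "('a, 'b) monoid_scheme \<Rightarrow> 'a \<Rightarrow> nat" where
  "induced_nc_degree G x =
     card {y \<in> carrier G - group_center G. noncentralizer_adj G x y}"

definition induced_regular :: "('a, 'b) monoid_scheme \<Rightarrow> bool" where
  "induced_regular G \<longleftrightarrow>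
     (\<forall>x \<in> carrier G - group_center G. \<forall>y \<in> carrier G - group_center G.
        induced_nc_degree G x = induced_nc_degree G y)"

definition is_p_group :: "('a, 'b) monoid_scheme \<Rightarrow> nat \<Rightarrow> bool" where
  "is_p_group H p \<longleftrightarrow> Factorial_Ring.prime p \<and> finite (carrier H) \<and> (\<exists>n. order H = p ^ n)"

end

theory Submission
  imports Defs "HOL-Number_Theory.Cong"
begin

text \<open>
  Regularity means that all classes \<open>{y. C y = C x}\<close> of noncentral elements have the same size
  \<open>c\<close>. Suppose that two different primes divide the index of the center \<open>Z\<close>, and split the group
  order into coprime factors \<open>a\<close> and \<open>b\<close> accordingly. The center of \<open>C x\<close> consists of \<open>Z\<close> and
  the classes of those \<open>y\<close> with \<open>C x \<subseteq> C y\<close>; for maximal \<open>C x\<close> there is only one such class,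
  and the center has order \<open>N = |Z| + c\<close>. Divisibility and covering arguments show that all
  noncentral centralizers are maximal, and then, thanks to the two primes, that they are abelian
  of order \<open>N\<close>. So all noncentral conjugacy classes have size \<open>m = |G| / N\<close>. With
  \<open>n = N / |Z|\<close> and \<open>t\<close> the number of centralizers, \<open>m n - 1 = t (n - 1)\<close>; hence \<open>m\<close> is
  coprime to \<open>t\<close> and \<open>n \<le> m\<close>. But \<open>m\<close> divides the numbers of noncentral elements of order
  dividing \<open>a\<close> and of order dividing \<open>b\<close>, each of which is a multiple of \<open>t\<close> with a small
  cofactor, and this forces \<open>m < n\<close>.
\<close>

section \<open>Centralizers and bicentralizers\<close>

lemma card_eq_mult_image:
  assumes "finite S" and "\<And>x. x \<in> S \<Longrightarrow> card {y \<in> S. g y = g x} = k"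
  shows "card S = k * card (g ` S)"
proof -
  have "card S = (\<Sum>x\<in>S. 1)" by simp
  also have "\<dots> = (\<Sum>y\<in>g ` S. card {x \<in> S. g x = y})"
    using sum.group[of S "g ` S" g "\<lambda>_. 1::nat"] assms(1) by simp
  also have "\<dots> = (\<Sum>y\<in>g ` S. k)"
    using assms(2) by (intro sum.cong) auto
  finally show ?thesis by simp
qed

context group
begin

lemma pow_card_subgroup:
  assumes "subgroup H G" and "x \<in> H"
  shows "x [^] card H = \<one>"
proof -
  interpret H: group "G\<lparr>carrier := H\<rparr>"
    using assms(1) by (rule subgroup_imp_group)
  have "x [^]\<^bsub>G\<lparr>carrier := H\<rparr>\<^esub> card H = \<one>"
    using H.pow_order_eq_1[of x] assms(2) by (simp add: order_def)
  then show ?thesis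
    by (subst nat_pow_consistent[of _ _ H])
qed

lemma subgroup_pow_closed:
  assumes "subgroup H G" and "x \<in> H"
  shows "x [^] (n::nat) \<in> H"
proof (induction n)
  case 0
  then show ?case using assms subgroup.one_closed by simp
next
  case (Suc n)
  then show ?case using assms subgroup.m_closed by simp
qed

lemma subgroup_mult_notin:
  assumes H: "subgroup H G" and h: "h \<in> H" and v: "v \<in> carrier G" "v \<notin> H"
  shows "h \<otimes> v \<notin> H"
proof
  assume "h \<otimes> v \<in> H"
  then have "inv h \<otimes> (h \<otimes> v) \<in> H"
    by (rule subgroup.m_closed[OF H subgroup.m_inv_closed[OF H h]])
  moreover have "h \<in> carrier G" using H h by (rule subgroup.mem_carrier)
  ultimately show False using v by (simp flip: m_assoc)
qed

lemma card_subgroup_dvd_card_subgroup: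
  assumes "subgroup H G" and "subgroup K G" and "H \<subseteq> K"
  shows "card H dvd card K"
proof -
  interpret K: group "G\<lparr>carrier := K\<rparr>"
    using assms(2) by (rule subgroup_imp_group)
  show ?thesis
    using K.lagrange[OF subgroup_incl[OF assms]]
    by (simp add: order_def) (metis dvd_triv_right)
qed

lemma card_proper_subgroup_le_half:
  assumes "finite K" and "subgroup H G" and "subgroup K G" and "H \<subset> K"
  shows "2 * card H \<le> card K"
proof -
  obtain d where d: "card K = card H * d"
    using card_subgroup_dvd_card_subgroup[of H K] assms by (meson dvdE psubset_imp_subset)
  have "card H < card K"
    using assms(1,4) by (rule psubset_card_mono)
  with d have "d \<noteq> 0" and "d \<noteq> 1" by auto
  then have "2 \<le> d" by simp
  then show ?thesis using d by (simp add: mult.commute)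
qed

section \<open>Centralizers, the center and bicentralizers\<close>

lemma centralizer_subset_pow:
  assumes "x \<in> carrier G"
  shows "centralizer G x \<subseteq> centralizer G (x [^] (n::nat))"
proof
  fix y assume "y \<in> centralizer G x"
  then show "y \<in> centralizer G (x [^] n)"
    using assms group_commutes_pow[of x y n] unfolding centralizer_def by auto
qed

lemma mem_group_center_iff:
  "x \<in> group_center G \<longleftrightarrow> x \<in> carrier G \<and> centralizer G x = carrier G"
  unfolding group_center_def centralizer_def by auto

lemma subgroup_centralizer:
  assumes x: "x \<in> carrier G"
  shows "subgroup (centralizer G x) G"
proof
  fix y w assume "y \<in> centralizer G x" "w \<in> centralizer G x"
  then have yw: "y \<in> carrier G" "w \<in> carrier G" "x \<otimes> y = y \<otimes> x" "x \<otimes> w = w \<otimes> x"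
    by (auto simp: centralizer_def)
  have "x \<otimes> (y \<otimes> w) = y \<otimes> w \<otimes> x"
    by (metis x yw m_assoc)
  then show "y \<otimes> w \<in> centralizer G x"
    using yw by (simp add: centralizer_def)
next
  fix y assume "y \<in> centralizer G x"
  then have y: "y \<in> carrier G" "x \<otimes> y = y \<otimes> x"
    by (auto simp: centralizer_def)
  have "x \<otimes> inv y = inv y \<otimes> (y \<otimes> x) \<otimes> inv y"
    using x y(1) by (simp flip: m_assoc)
  also have "\<dots> = inv y \<otimes> x"
    using x y(1) by (simp add: m_assoc flip: y(2))
  finally show "inv y \<in> centralizer G x"
    using y by (simp add: centralizer_def)
qed (use x in \<open>auto simp: centralizer_def\<close>)

lemma mem_centralizer_sym:
  assumes "x \<in> carrier G" and "y \<in> centralizer G x"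
  shows "x \<in> centralizer G y"
  using assms unfolding centralizer_def by auto

text \<open>This is the center of the centralizer of \<open>x\<close>.\<close>

definition bicentralizer :: "'a \<Rightarrow> 'a set" where
  "bicentralizer x = {y \<in> carrier G. centralizer G x \<subseteq> centralizer G y}"

lemma bicentralizer_mem_carrier: "y \<in> bicentralizer x \<Longrightarrow> y \<in> carrier G"
  by (simp add: bicentralizer_def)

text \<open>Since commuting is symmetric, \<open>bicentralizer x\<close> is the intersection of the
  subgroups \<open>centralizer G g\<close> for \<open>g\<close> in
  \<open>centralizer G x\<close>.\<close>

lemma subgroup_bicentralizer:
  assumes "x \<in> carrier G"
  shows "subgroup (bicentralizer x) G"
proof
  show "\<one> \<in> bicentralizer x"
    by (auto simp: bicentralizer_def centralizer_def)
next
  fix y w assume yw: "y \<in> bicentralizer x" "w \<in> bicentralizer x"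
  show "y \<otimes> w \<in> bicentralizer x"
    unfolding bicentralizer_def
  proof (intro CollectI conjI subsetI)
    fix g assume g: "g \<in> centralizer G x"
    then have "g \<in> carrier G" by (simp add: centralizer_def)
    moreover have "y \<in> centralizer G g" "w \<in> centralizer G g"
      using g yw mem_centralizer_sym[of y g] mem_centralizer_sym[of w g]
      unfolding bicentralizer_def by blast+
    ultimately have "y \<otimes> w \<in> centralizer G g"
      by (intro subgroup.m_closed subgroup_centralizer)
    then show "g \<in> centralizer G (y \<otimes> w)"
      by (rule mem_centralizer_sym[OF \<open>g \<in> carrier G\<close>])
  qed (use yw in \<open>auto simp: bicentralizer_def\<close>)
next
  fix y assume y: "y \<in> bicentralizer x"
  show "inv y \<in> bicentralizer x"
    unfolding bicentralizer_def
  proof (intro CollectI conjI subsetI)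
    fix g assume g: "g \<in> centralizer G x"
    then have "g \<in> carrier G" by (simp add: centralizer_def)
    moreover have "y \<in> centralizer G g"
      using g y mem_centralizer_sym[of y g] unfolding bicentralizer_def by blast
    ultimately have "inv y \<in> centralizer G g"
      by (intro subgroup.m_inv_closed subgroup_centralizer)
    then show "g \<in> centralizer G (inv y)"
      by (rule mem_centralizer_sym[OF \<open>g \<in> carrier G\<close>])
  qed (use y in \<open>auto simp: bicentralizer_def\<close>)
qed (auto simp: bicentralizer_def)

lemma group_center_eq_bicentralizer_one: "group_center G = bicentralizer \<one>"
  unfolding group_center_def bicentralizer_def centralizer_def by auto

lemma subgroup_group_center: "subgroup (group_center G) G"
  using subgroup_bicentralizer[of \<one>] group_center_eq_bicentralizer_one by simp

lemma group_center_commute: "x \<in> group_center G \<Longrightarrow> y \<in> group_center G \<Longrightarrow> x \<otimes> y = y \<otimes> x"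
  unfolding group_center_def by blast

lemma group_center_subset_bicentralizer: "group_center G \<subseteq> bicentralizer x"
  unfolding bicentralizer_def group_center_def centralizer_def by auto

lemma bicentralizer_mono:
  "y \<in> bicentralizer x \<Longrightarrow> bicentralizer y \<subseteq> bicentralizer x"
  unfolding bicentralizer_def by auto

lemma self_mem_bicentralizer: "x \<in> carrier G \<Longrightarrow> x \<in> bicentralizer x"
  by (simp add: bicentralizer_def)

lemma bicentralizer_subset_centralizer:
  assumes "x \<in> carrier G"
  shows "bicentralizer x \<subseteq> centralizer G x"
proof
  fix y assume "y \<in> bicentralizer x"
  moreover have "x \<in> centralizer G x" using assms by (simp add: centralizer_def)
  ultimately show "y \<in> centralizer G x"
    using mem_centralizer_sym[of y x] unfolding bicentralizer_def by auto
qed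

lemma bicentralizer_commute:
  assumes "x \<in> carrier G" and "y \<in> bicentralizer x" and "w \<in> bicentralizer x"
  shows "y \<otimes> w = w \<otimes> y"
proof -
  have "w \<in> centralizer G y"
    using assms bicentralizer_subset_centralizer unfolding bicentralizer_def by auto
  then show ?thesis by (simp add: centralizer_def)
qed

text \<open>By Cauchy's theorem (Sylow's with exponent 1), a prime \<open>q\<close> dividing both
  numbers would yield a nontrivial element of \<open>H\<close> whose order divides \<open>q\<close>
  and \<open>a\<close>, which are coprime.\<close>

lemma card_torsion_coprime:
  assumes "finite H" and H: "subgroup H G" and tors: "\<And>h. h \<in> H \<Longrightarrow> h [^] (a::nat) = \<one>"
    and "coprime a b"
  shows "coprime (card H) b"
proof (rule ccontr)
  assume "\<not> coprime (card H) b"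
  then have "gcd (card H) b \<noteq> 1"
    by (simp add: coprime_iff_gcd_eq_1)
  then obtain q where q: "Factorial_Ring.prime q" "q dvd card H" "q dvd b"
    using prime_factor_nat[of "gcd (card H) b"] by (meson gcd_greatest_iff)
  interpret H: group "G\<lparr>carrier := H\<rparr>"
    using H by (rule subgroup_imp_group)
  obtain K where K: "subgroup K (G\<lparr>carrier := H\<rparr>)" "card K = q"
    using sylow_thm[of q "G\<lparr>carrier := H\<rparr>" 1 "card H div q"] q \<open>finite H\<close> H.is_group
    by (auto simp: order_def)
  have KG: "subgroup K G" using K(1) H incl_subgroup by blast
  have "1 < card K" using q(1) K(2) prime_gt_1_nat by auto
  then obtain x where x: "x \<in> K" "x \<noteq> \<one>"
    by (metis One_nat_def card_le_Suc0_iff_eq card.infinite not_less zero_less_one_class.zero_le_one)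
  have xG: "x \<in> carrier G" "x \<in> H"
    using x KG K(1) subgroup.subset by fastforce+
  have "ord x dvd q" "ord x dvd a"
    using pow_card_subgroup[OF KG x(1)] tors xG pow_eq_id K(2) by auto
  moreover have "coprime q a"
    using \<open>coprime a b\<close> q(3) by (metis coprime_commute coprime_divisors dvd_refl)
  ultimately have "ord x = 1"
    using coprime_common_divisor_nat by blast
  then show False using x xG ord_eq_1 by blast
qed

end

section \<open>Splitting off coprime parts\<close>

text \<open>
  The exponents \<open>e\<close> and \<open>f\<close> are the idempotents of the Chinese remainder theorem, so that
  \<open>x = x [^] e \<otimes> x [^] f\<close> is the decomposition of \<open>x\<close> into commuting parts
  of orders dividing \<open>a\<close> and \<open>b\<close>.
\<close>

locale coprime_split = group G for G (structure) +
  fixes a b e f :: nat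
  assumes finite_carrier: "finite (carrier G)"
    and order_eq: "order G = a * b"
    and coprime_ab: "coprime a b"
    and e_cong: "[e = 1] (mod a)" and e_dvd: "b dvd e"
    and f_cong: "[f = 1] (mod b)" and f_dvd: "a dvd f"
begin

text \<open>The setting is symmetric in the two factors; interpreting this instance as
  \<open>sw\<close> makes each one-sided fact available for \<open>b\<close> and \<open>f\<close>
  too.\<close>

lemma swap: "coprime_split G b a f e"
  using order_eq coprime_ab e_cong e_dvd f_cong f_dvd finite_carrier
  by unfold_locales (simp_all add: mult.commute coprime_commute)

lemma pow_dvd_eq_one:
  assumes "x [^] k = \<one>" and "k dvd l" and "x \<in> carrier G"
  shows "x [^] (l::nat) = \<one>"
  using assms pow_eq_id dvd_trans by metis

lemma pow_eq_self:
  assumes "x [^] k = \<one>" and "[l = 1] (mod k)" and x: "x \<in> carrier G"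
  shows "x [^] (l::nat) = x"
proof -
  obtain r s where "l + k * r = 1 + k * s"
    using assms(2) by (metis cong_iff_lin_nat mult.commute)
  then have "x [^] (l + k * r) = x [^] (1 + k * s)" by simp
  moreover have "x [^] (k * i) = \<one>" for i
    using pow_dvd_eq_one[OF assms(1) _ x] by simp
  ultimately show ?thesis
    using x by (simp flip: nat_pow_mult)
qed

lemma pow_e_torsion:
  assumes "x \<in> carrier G"
  shows "(x [^] e) [^] a = \<one>"
proof -
  have "order G dvd e * a"
    using e_dvd order_eq by (metis dvd_refl mult.commute mult_dvd_mono)
  then show ?thesis
    using pow_dvd_eq_one[OF pow_order_eq_1] assms by (simp add: nat_pow_pow)
qed

lemma pow_e_of_torsion: "x \<in> carrier G \<Longrightarrow> x [^] a = \<one> \<Longrightarrow> x [^] e = x"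
  using pow_eq_self e_cong by blast

lemma pow_e_of_cotorsion: "x \<in> carrier G \<Longrightarrow> x [^] b = \<one> \<Longrightarrow> x [^] e = \<one>"
  using pow_dvd_eq_one e_dvd by blast

lemma pow_e_mult_pow_f:
  assumes "x \<in> carrier G"
  shows "x [^] e \<otimes> x [^] f = x"
proof -
  have "[e + f = 1 + 0] (mod a)"
    using e_cong f_dvd by (intro cong_add) (auto simp: cong_0_iff)
  moreover have "[e + f = 0 + 1] (mod b)"
    using f_cong e_dvd by (intro cong_add) (auto simp: cong_0_iff)
  ultimately have "[e + f = 1] (mod order G)"
    using coprime_cong_mult_nat coprime_ab order_eq by simp
  then show ?thesis
    using pow_eq_self[OF pow_order_eq_1] assms by (simp add: nat_pow_mult)
qed

lemma subgroup_torsion: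
  assumes H: "subgroup H G" and comm: "\<And>x y. x \<in> H \<Longrightarrow> y \<in> H \<Longrightarrow> x \<otimes> y = y \<otimes> x"
  shows "subgroup {h \<in> H. h [^] (k::nat) = \<one>} G"
proof
  have sub: "H \<subseteq> carrier G" using H by (rule subgroup.subset)
  then show "{h \<in> H. h [^] k = \<one>} \<subseteq> carrier G" by auto
  show "\<one> \<in> {h \<in> H. h [^] k = \<one>}"
    using H subgroup.one_closed by simp
  fix x assume x: "x \<in> {h \<in> H. h [^] k = \<one>}"
  then show "inv x \<in> {h \<in> H. h [^] k = \<one>}"
    using H sub subgroup.m_inv_closed by (auto simp: nat_pow_inv subset_iff)
  fix y assume y: "y \<in> {h \<in> H. h [^] k = \<one>}"
  have "(x \<otimes> y) [^] k = \<one>"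
    using x y sub by (subst pow_mult_distrib[OF comm]) auto
  then show "x \<otimes> y \<in> {h \<in> H. h [^] k = \<one>}"
    using x y H subgroup.m_closed by auto
qed

lemma card_torsion_dvd:
  assumes H: "subgroup H G" and comm: "\<And>x y. x \<in> H \<Longrightarrow> y \<in> H \<Longrightarrow> x \<otimes> y = y \<otimes> x"
  shows "card {h \<in> H. h [^] a = \<one>} dvd a"
proof -
  let ?T = "{h \<in> H. h [^] a = \<one>}"
  have T: "subgroup ?T G" using assms by (rule subgroup_torsion)
  have "finite ?T"
    using finite_carrier subgroup.subset[OF T] by (rule finite_subset[rotated])
  then have "coprime (card ?T) b"
    by (rule card_torsion_coprime[OF _ T _ coprime_ab]) simp
  moreover have "card ?T dvd a * b"
    unfolding order_eq[symmetric] lagrange[OF T, symmetric] by (rule dvd_triv_right)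
  ultimately show ?thesis
    by (simp add: coprime_dvd_mult_left_iff)
qed

text \<open>In a commutative subgroup the parts \<open>h [^] e\<close> and \<open>h [^] f\<close>
  can be prescribed independently, and multiplication recombines them.\<close>

lemma card_eq_torsion_mult:
  assumes H: "subgroup H G" and comm: "\<And>x y. x \<in> H \<Longrightarrow> y \<in> H \<Longrightarrow> x \<otimes> y = y \<otimes> x"
  shows "card H = card {h \<in> H. h [^] a = \<one>} * card {h \<in> H. h [^] b = \<one>}"
proof -
  interpret sw: coprime_split G b a f e by (rule swap)
  have sub: "x \<in> H \<Longrightarrow> x \<in> carrier G" for x using H subgroup.subset by blast
  have "bij_betw (\<lambda>h. (h [^] e, h [^] f)) H ({h \<in> H. h [^] a = \<one>} \<times> {h \<in> H. h [^] b = \<one>})"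
  proof (rule bij_betw_byWitness[where f' = "\<lambda>(u, v). u \<otimes> v"])
    show "\<forall>h\<in>H. (case (h [^] e, h [^] f) of (u, v) \<Rightarrow> u \<otimes> v) = h"
      using sub pow_e_mult_pow_f by simp
    show "\<forall>p\<in>{h \<in> H. h [^] a = \<one>} \<times> {h \<in> H. h [^] b = \<one>}.
        ((case p of (u, v) \<Rightarrow> u \<otimes> v) [^] e, (case p of (u, v) \<Rightarrow> u \<otimes> v) [^] f) = p"
    proof (rule ballI)
      fix p assume "p \<in> {h \<in> H. h [^] a = \<one>} \<times> {h \<in> H. h [^] b = \<one>}"
      then obtain u v where p: "p = (u, v)"
        and uv: "u \<in> H" "v \<in> H" "u [^] a = \<one>" "v [^] b = \<one>"
        by auto
      then have "(u \<otimes> v) [^] (k::nat) = u [^] k \<otimes> v [^] k" for k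
        using pow_mult_distrib[OF comm] sub by blast
      then show "((case p of (u, v) \<Rightarrow> u \<otimes> v) [^] e, (case p of (u, v) \<Rightarrow> u \<otimes> v) [^] f) = p"
        using p uv sub by (simp add: pow_e_of_torsion pow_e_of_cotorsion
            sw.pow_e_of_torsion sw.pow_e_of_cotorsion)
    qed
    show "(\<lambda>h. (h [^] e, h [^] f)) ` H \<subseteq> {h \<in> H. h [^] a = \<one>} \<times> {h \<in> H. h [^] b = \<one>}"
      using subgroup_pow_closed[OF H] pow_e_torsion sw.pow_e_torsion sub by auto
    show "(\<lambda>(u, v). u \<otimes> v) ` ({h \<in> H. h [^] a = \<one>} \<times> {h \<in> H. h [^] b = \<one>}) \<subseteq> H"
      using subgroup.m_closed[OF H] by auto
  qed
  then show ?thesis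
    by (simp add: bij_betw_same_card card_cartesian_product)
qed

text \<open>The two torsion subgroups have orders dividing \<open>a\<close> and \<open>b\<close>, so
  only the first contributes to the gcd with \<open>a\<close>.\<close>

lemma card_torsion_eq_gcd:
  assumes H: "subgroup H G" and comm: "\<And>x y. x \<in> H \<Longrightarrow> y \<in> H \<Longrightarrow> x \<otimes> y = y \<otimes> x"
  shows "card {h \<in> H. h [^] a = \<one>} = gcd (card H) a"
proof -
  interpret sw: coprime_split G b a f e by (rule swap)
  let ?s = "card {h \<in> H. h [^] a = \<one>}" and ?t = "card {h \<in> H. h [^] b = \<one>}"
  have "?s dvd a" "?t dvd b"
    using card_torsion_dvd[OF assms] sw.card_torsion_dvd[OF assms] by blast+
  then have "coprime ?t a"
    using coprime_ab by (meson coprime_commute coprime_divisors dvd_refl)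
  then have "gcd (?s * ?t) a = gcd ?s a"
    using gcd_mult_left_right_cancel[of a ?t ?s]
    by (simp add: ac_simps)
  then show ?thesis
    using card_eq_torsion_mult[OF assms] \<open>?s dvd a\<close> by (simp add: gcd_nat.absorb1)
qed

lemma card_eq_gcd_mult_gcd:
  assumes H: "subgroup H G" and comm: "\<And>x y. x \<in> H \<Longrightarrow> y \<in> H \<Longrightarrow> x \<otimes> y = y \<otimes> x"
  shows "card H = gcd (card H) a * gcd (card H) b"
  using card_eq_torsion_mult[OF assms] card_torsion_eq_gcd[OF assms]
    coprime_split.card_torsion_eq_gcd[OF swap assms] by simp

end

section \<open>Maximal centralizers\<close>

text \<open>In the applications \<open>z\<close> is the order of the center and
  \<open>z * (n - 1)\<close> the class size \<open>c\<close>. Classes partition the rest of a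
  subgroup of order \<open>d * (z * n)\<close>, and this forces \<open>n <= d\<close> once
  \<open>d\<close> exceeds 1. The key is \<open>d * n - 1 = d * (n - 1) + (d - 1)\<close>.\<close>

lemma pred_dvd_mult_pred:
  fixes n d z :: nat
  assumes "0 < z" and "0 < d" and "0 < n" and "z * (n - 1) dvd d * (z * n) - z"
  shows "n - 1 dvd d - 1"
proof -
  have "d * (z * n) - z = z * (d * n - 1)"
    by (simp add: algebra_simps)
  then have "n - 1 dvd d * n - 1" using assms by simp
  moreover have "d * n - 1 = d * (n - 1) + (d - 1)"
    using assms(2,3) by (cases d; cases n) (auto simp: algebra_simps)
  ultimately show ?thesis by (simp add: dvd_add_right_iff)
qed

text \<open>
  The assumptions of this locale are contradictory: \<open>c\<close> is the common size of the classes
  of noncentral elements with equal centralizers, and the index of the center is divisible by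
  primes from both coprime factors of the group order.
\<close>

locale regular_split = coprime_split +
  fixes c :: nat
  assumes class_card:
      "\<And>x. x \<in> carrier G - group_center G \<Longrightarrow>
        card {y \<in> carrier G. centralizer G y = centralizer G x} = c"
    and ex_noncentral_a: "\<exists>x \<in> carrier G - group_center G. x [^] a = \<one>"
    and ex_noncentral_b: "\<exists>x \<in> carrier G - group_center G. x [^] b = \<one>"
begin

lemma regular_swap: "regular_split G b a f e c"
  by (intro regular_split.intro swap regular_split_axioms.intro class_card
      ex_noncentral_a ex_noncentral_b)

abbreviation Z :: "'a set" where "Z \<equiv> group_center G"

abbreviation C :: "'a \<Rightarrow> 'a set" where "C \<equiv> centralizer G"

text \<open>The order of the bicentralizer of any maximal element: the center plus one
  class.\<close>

abbreviation N :: nat where "N \<equiv> card Z + c"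

definition maximal :: "'a \<Rightarrow> bool" where
  "maximal x \<longleftrightarrow> x \<in> carrier G - Z \<and> (\<forall>y \<in> carrier G - Z. C x \<subseteq> C y \<longrightarrow> C y = C x)"

lemma finite_bicentralizer: "finite (bicentralizer x)"
  using finite_carrier by (simp add: bicentralizer_def)

lemma finite_Z: "finite Z"
  using finite_carrier by (simp add: group_center_def)

lemma card_Z_pos: "0 < card Z"
  using finite_Z subgroup.one_closed[OF subgroup_group_center] by (auto simp: card_gt_0_iff)

lemma class_subset_bicentralizer:
  assumes "x \<in> carrier G - Z"
  shows "{y \<in> carrier G. C y = C x} \<subseteq> bicentralizer x - Z"
  using assms mem_group_center_iff by (auto simp: bicentralizer_def)

lemma card_bicentralizer_minus: "card (bicentralizer x - Z) = card (bicentralizer x) - card Z"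
  by (rule card_Diff_subset[OF finite_Z group_center_subset_bicentralizer])

lemma card_Z_le_card_bicentralizer: "card Z \<le> card (bicentralizer x)"
  by (rule card_mono[OF finite_bicentralizer group_center_subset_bicentralizer])

text \<open>The class of \<open>x\<close> lies in the noncentral part of
  \<open>bicentralizer x\<close>, and the two agree exactly when no noncentral element has a
  strictly larger centralizer. Both sets are finite, so comparing sizes decides this.\<close>

lemma maximal_iff_card:
  assumes x: "x \<in> carrier G - Z"
  shows "maximal x \<longleftrightarrow> card (bicentralizer x) = N"
proof -
  have "maximal x \<longleftrightarrow> bicentralizer x - Z \<subseteq> {y \<in> carrier G. C y = C x}"
    using x unfolding maximal_def bicentralizer_def by blast
  also have "\<dots> \<longleftrightarrow> {y \<in> carrier G. C y = C x} = bicentralizer x - Z"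
    using class_subset_bicentralizer[OF x] by blast
  also have "\<dots> \<longleftrightarrow> card {y \<in> carrier G. C y = C x} = card (bicentralizer x - Z)"
    using card_subset_eq[OF _ class_subset_bicentralizer[OF x]] finite_bicentralizer by auto
  also have "\<dots> \<longleftrightarrow> card (bicentralizer x) = N"
    using class_card[OF x] card_bicentralizer_minus[of x] card_Z_le_card_bicentralizer[of x] by auto
  finally show ?thesis .
qed

lemma maximal_eq:
  assumes "maximal x" and "y \<in> bicentralizer x - Z"
  shows "C y = C x"
  using assms unfolding maximal_def bicentralizer_def by blast

lemma maximal_mem: "maximal x \<Longrightarrow> x \<in> carrier G - Z"
  by (simp add: maximal_def)

lemma ex_centralizer_maximal_on:
  assumes "S \<subseteq> carrier G" and "S \<noteq> {}"
  obtains x where "x \<in> S" and "\<And>y. y \<in> S \<Longrightarrow> C x \<subseteq> C y \<Longrightarrow> C y = C x"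
proof -
  have "finite S" using assms(1) finite_carrier by (rule finite_subset)
  then obtain M where "M \<in> C ` S" and "\<forall>L\<in>C ` S. M \<subseteq> L \<longrightarrow> M = L"
    using finite_has_maximal[of "C ` S"] assms(2) by auto
  then obtain x where "x \<in> S" and "M = C x" and "\<forall>y\<in>S. C x \<subseteq> C y \<longrightarrow> C x = C y"
    by auto
  then show ?thesis using that[of x] by auto
qed

lemma ex_maximal:
  assumes "x \<in> carrier G - Z"
  shows "\<exists>y. maximal y \<and> y \<in> bicentralizer x"
proof -
  obtain y where y: "y \<in> bicentralizer x - Z"
    and max: "\<And>w. w \<in> bicentralizer x - Z \<Longrightarrow> C y \<subseteq> C w \<Longrightarrow> C w = C y"
    using ex_centralizer_maximal_on[of "bicentralizer x - Z"] assms self_mem_bicentralizer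
    by (metis DiffD1 DiffD2 DiffI bicentralizer_mem_carrier empty_iff subsetI)
  then show ?thesis unfolding maximal_def bicentralizer_def by blast
qed

text \<open>Lagrange's theorem for the bicentralizer of a maximal element of
  \<open>bicentralizer x\<close>, a subgroup of order \<open>N\<close>.\<close>

lemma N_dvd_card_bicentralizer:
  assumes "x \<in> carrier G - Z"
  shows "N dvd card (bicentralizer x)"
proof -
  obtain y where y: "maximal y" "y \<in> bicentralizer x" using ex_maximal[OF assms] by blast
  then have "card (bicentralizer y) = N" using maximal_iff_card maximal_mem by blast
  moreover have "card (bicentralizer y) dvd card (bicentralizer x)"
    using y assms maximal_mem[OF y(1)]
    by (intro card_subgroup_dvd_card_subgroup subgroup_bicentralizer bicentralizer_mono) auto
  ultimately show ?thesis by simp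
qed

lemma card_eq_c_mult_card_image:
  assumes "S \<subseteq> carrier G - Z" and "\<And>x y. x \<in> S \<Longrightarrow> y \<in> carrier G \<Longrightarrow> C y = C x \<Longrightarrow> y \<in> S"
  shows "card S = c * card (C ` S)"
proof (rule card_eq_mult_image)
  show "finite S" using assms(1) finite_carrier by (meson finite_Diff finite_subset)
  fix x assume x: "x \<in> S"
  then have "{y \<in> S. C y = C x} = {y \<in> carrier G. C y = C x}" using assms by blast
  then show "card {y \<in> S. C y = C x} = c" using class_card x assms(1) by auto
qed

text \<open>The noncentral part of a bicentralizer is a disjoint union of classes of size
  \<open>c\<close>.\<close>

lemma c_dvd_card_bicentralizer:
  assumes "x \<in> carrier G"
  shows "c dvd card (bicentralizer x) - card Z"
proof -
  have "card (bicentralizer x - Z) = c * card (C ` (bicentralizer x - Z))"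
  proof (rule card_eq_c_mult_card_image)
    show "bicentralizer x - Z \<subseteq> carrier G - Z" by (auto simp: bicentralizer_def)
    show "w \<in> bicentralizer x - Z" if "y \<in> bicentralizer x - Z" "w \<in> carrier G" "C w = C y" for y w
      using that mem_group_center_iff unfolding bicentralizer_def by auto
  qed
  then show ?thesis using card_bicentralizer_minus by (metis dvd_triv_left)
qed

text \<open>
  Every element outside the proper subgroup \<open>{y. y [^] e \<in> Z}\<close> of the bicentralizer has the same
  centralizer as \<open>x\<close>, so the class of \<open>x\<close> fills more than half of the bicentralizer, whose
  order is a multiple of \<open>N\<close>.
\<close>

lemma torsion_maximal:
  assumes x: "x \<in> carrier G - Z" "x [^] a = \<one>"
    and max: "\<And>y. y \<in> carrier G - Z \<Longrightarrow> y [^] a = \<one> \<Longrightarrow> C x \<subseteq> C y \<Longrightarrow> C y = C x"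
  shows "maximal x"
proof -
  let ?A = "bicentralizer x"
  let ?D = "{y \<in> ?A. y [^] e \<in> Z}"
  have xG: "x \<in> carrier G" using x by simp
  have A: "subgroup ?A G" using xG by (rule subgroup_bicentralizer)
  have D: "subgroup ?D G"
  proof
    show "?D \<subseteq> carrier G" using bicentralizer_mem_carrier by auto
    show "\<one> \<in> ?D"
      using subgroup.one_closed[OF A] subgroup.one_closed[OF subgroup_group_center] by simp
    fix y assume y: "y \<in> ?D"
    then show "inv y \<in> ?D"
      using subgroup.m_inv_closed[OF A] subgroup.m_inv_closed[OF subgroup_group_center]
      by (auto simp: nat_pow_inv bicentralizer_mem_carrier)
    fix w assume w: "w \<in> ?D"
    have "(y \<otimes> w) [^] e = y [^] e \<otimes> w [^] e"
      using y w bicentralizer_commute[OF xG]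
      by (intro pow_mult_distrib) (auto simp: bicentralizer_mem_carrier)
    then show "y \<otimes> w \<in> ?D"
      using y w subgroup.m_closed[OF A] subgroup.m_closed[OF subgroup_group_center] by auto
  qed
  have "x \<in> ?A - ?D"
    using x pow_e_of_torsion self_mem_bicentralizer by auto
  then have half: "2 * card ?D \<le> card ?A"
    by (intro card_proper_subgroup_le_half finite_bicentralizer D A) auto
  \<comment> \<open>For \<open>y\<close> outside \<open>?D\<close> the power \<open>y [^] e\<close>
    is noncentral of order dividing \<open>a\<close>, so \<open>max\<close> makes
    \<open>C (y [^] e)\<close> equal to \<open>C x\<close>, and \<open>C y\<close> is squeezed
    between them.\<close>
  have "?A - ?D \<subseteq> {y \<in> carrier G. C y = C x}"
  proof
    fix y assume y: "y \<in> ?A - ?D"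
    then have yG: "y \<in> carrier G" using bicentralizer_mem_carrier by blast
    have sub: "C x \<subseteq> C y" using y by (simp add: bicentralizer_def)
    have sub': "C y \<subseteq> C (y [^] e)" using yG by (rule centralizer_subset_pow)
    have "C (y [^] e) = C x"
      using y yG sub sub' by (intro max pow_e_torsion) auto
    then show "y \<in> {y \<in> carrier G. C y = C x}" using sub sub' yG by auto
  qed
  then have "card (?A - ?D) \<le> c"
    using class_card[OF x(1)] finite_carrier card_mono[of "{y \<in> carrier G. C y = C x}" "?A - ?D"]
    by simp
  moreover have "card (?A - ?D) = card ?A - card ?D"
    using finite_bicentralizer by (intro card_Diff_subset) auto
  \<comment> \<open>Since \<open>?D\<close> takes up at most half of \<open>?A\<close>, the order of
    \<open>?A\<close> is at most \<open>2 * c\<close>, and \<open>c < N\<close>.\<close>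
  ultimately have less: "card ?A < N * 2" using half card_Z_pos by arith
  obtain d where d: "card ?A = N * d" using N_dvd_card_bicentralizer[OF x(1)] by blast
  have "d < 2" using less unfolding d by (rule mult_less_cancel1[THEN iffD1, THEN conjunct2])
  moreover have "d \<noteq> 0"
    using d card_Z_pos card_Z_le_card_bicentralizer[of x] by (intro notI) simp
  ultimately have "d = 1" by linarith
  then show ?thesis using d maximal_iff_card[OF x(1)] by simp
qed

lemma ex_torsion_maximal: "\<exists>x. maximal x \<and> x [^] a = \<one>"
proof -
  let ?S = "{y \<in> carrier G - Z. y [^] a = \<one>}"
  have "?S \<subseteq> carrier G" "?S \<noteq> {}" using ex_noncentral_a by auto
  then obtain x where x: "x \<in> ?S" and max: "\<And>w. w \<in> ?S \<Longrightarrow> C x \<subseteq> C w \<Longrightarrow> C w = C x"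
    using ex_centralizer_maximal_on[of ?S] by blast
  then have "maximal x" by (intro torsion_maximal) auto
  then show ?thesis using x by blast
qed

section \<open>Torsion parts of maximal bicentralizers\<close>

lemma card_torsion_center: "card {h \<in> Z. h [^] a = \<one>} = gcd (card Z) a"
  by (rule card_torsion_eq_gcd[OF subgroup_group_center group_center_commute])

lemma card_torsion_bicentralizer:
  assumes "maximal x"
  shows "card {h \<in> bicentralizer x. h [^] a = \<one>} = gcd N a"
proof -
  have x: "x \<in> carrier G - Z" using assms by (rule maximal_mem)
  show ?thesis
    using card_torsion_eq_gcd[of "bicentralizer x"] subgroup_bicentralizer bicentralizer_commute
      assms x maximal_iff_card[OF x] by auto
qed

text \<open>A maximal element of order dividing \<open>a\<close> lies in the torsion of its own
  bicentralizer but not in the center, so the inclusion of torsion subgroups is strict.\<close>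

lemma gcd_card_Z_less: "gcd (card Z) a < gcd N a"
proof -
  obtain x where x: "maximal x" "x [^] a = \<one>" using ex_torsion_maximal by blast
  then have xG: "x \<in> carrier G" "x \<notin> Z" using maximal_mem by auto
  have "x \<in> {h \<in> bicentralizer x. h [^] a = \<one>} - {h \<in> Z. h [^] a = \<one>}"
    using x xG self_mem_bicentralizer by simp
  then have "{h \<in> Z. h [^] a = \<one>} \<subset> {h \<in> bicentralizer x. h [^] a = \<one>}"
    using group_center_subset_bicentralizer[of x] by blast
  then have "card {h \<in> Z. h [^] a = \<one>} < card {h \<in> bicentralizer x. h [^] a = \<one>}"
    using finite_bicentralizer by (intro psubset_card_mono) auto
  then show ?thesis using card_torsion_center card_torsion_bicentralizer[OF x(1)] by simp
qed

text \<open>The number of such torsion elements in a maximal bicentralizer depends only on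
  \<open>N\<close>, so the strict inequality found for one maximal element passes to all.\<close>

lemma maximal_has_torsion:
  assumes "maximal x"
  shows "\<exists>u \<in> bicentralizer x - Z. u [^] a = \<one>"
proof (rule ccontr)
  assume "\<not> ?thesis"
  then have "{h \<in> bicentralizer x. h [^] a = \<one>} \<subseteq> {h \<in> Z. h [^] a = \<one>}" by auto
  then have "card {h \<in> bicentralizer x. h [^] a = \<one>} \<le> card {h \<in> Z. h [^] a = \<one>}"
    using finite_Z by (intro card_mono) auto
  then show False
    using gcd_card_Z_less card_torsion_center card_torsion_bicentralizer[OF assms] by simp
qed

text \<open>\<open>na\<close> and \<open>nb\<close> are the coprime parts of the index of the center
  in a maximal bicentralizer. Neither is 1, and being coprime they are not both 2; the resulting 6
  matches the number of translates used in \<open>all_maximal\<close>.\<close>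

lemma N_factorization:
  obtains na nb where "gcd N a = gcd (card Z) a * na" and "gcd N b = gcd (card Z) b * nb"
    and "2 \<le> na" and "2 \<le> nb" and "6 \<le> na * nb" and "N = card Z * (na * nb)"
proof -
  interpret sw: regular_split G b a f e c by (rule regular_swap)
  obtain x where "maximal x" using ex_torsion_maximal by blast
  then have x: "x \<in> carrier G" and card_x: "card (bicentralizer x) = N"
    using maximal_mem maximal_iff_card by blast+
  have Zdvd: "card Z dvd N"
    using card_subgroup_dvd_card_subgroup[OF subgroup_group_center subgroup_bicentralizer[OF x]]
      group_center_subset_bicentralizer card_x by simp
  have N: "N = gcd N a * gcd N b"
    using card_eq_gcd_mult_gcd[OF subgroup_bicentralizer[OF x]] bicentralizer_commute[OF x] card_x
    by simp
  have Z: "card Z = gcd (card Z) a * gcd (card Z) b"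
    by (rule card_eq_gcd_mult_gcd[OF subgroup_group_center group_center_commute])
  obtain na nb where na: "gcd N a = gcd (card Z) a * na" and nb: "gcd N b = gcd (card Z) b * nb"
    using gcd_mono[OF Zdvd dvd_refl] by (meson dvdE)
  have "na \<noteq> 0" "na \<noteq> 1" "nb \<noteq> 0" "nb \<noteq> 1"
    using gcd_card_Z_less sw.gcd_card_Z_less na nb by auto
  then have two: "2 \<le> na" "2 \<le> nb" by auto
  have "na dvd a" "nb dvd b"
    using na nb by (metis dvd_mult_right gcd_dvd2)+
  then have "coprime na nb" using coprime_ab coprime_divisors by blast
  then have "na \<noteq> 2 \<or> nb \<noteq> 2" by auto
  then have "6 \<le> na * nb"
  proof
    assume "na \<noteq> 2"
    then have "3 * 2 \<le> na * nb" using two by (intro mult_le_mono) auto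
    then show ?thesis by simp
  next
    assume "nb \<noteq> 2"
    then have "2 * 3 \<le> na * nb" using two by (intro mult_le_mono) auto
    then show ?thesis by simp
  qed
  moreover have "N = card Z * (na * nb)"
    using N na nb Z by (metis mult.assoc mult.left_commute)
  ultimately show thesis by (rule that[OF na nb two])
qed

text \<open>
  For \<open>x\<close> just below the maximal level, six translates of the class of \<open>x\<close> cover
  the bicentralizer, which contradicts a divisibility bound on its order.
\<close>

lemma all_maximal:
  assumes "x \<in> carrier G - Z"
  shows "maximal x"
proof (rule ccontr)
  interpret sw: regular_split G b a f e c by (rule regular_swap)
  assume "\<not> maximal x"
  then have "{y \<in> carrier G - Z. \<not> maximal y} \<noteq> {}" using assms by blast
  \<comment> \<open>Among the nonmaximal elements \<open>x\<close> has a largest centralizer, so a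
    noncentral member of its bicentralizer is either maximal or in the class of
    \<open>x\<close>.\<close>
  then obtain x where "x \<in> {y \<in> carrier G - Z. \<not> maximal y}"
    and submax: "\<And>y. y \<in> {y \<in> carrier G - Z. \<not> maximal y} \<Longrightarrow> C x \<subseteq> C y \<Longrightarrow> C y = C x"
    using ex_centralizer_maximal_on[of "{y \<in> carrier G - Z. \<not> maximal y}"] by blast
  then have x: "x \<in> carrier G - Z" "\<not> maximal x" by auto
  then have xG: "x \<in> carrier G" by simp
  let ?A = "bicentralizer x" and ?K = "{y \<in> carrier G. C y = C x}"
  have A: "subgroup ?A G" using xG by (rule subgroup_bicentralizer)
  have AG: "y \<in> carrier G" if "y \<in> ?A" for y using that by (rule bicentralizer_mem_carrier)
  have Apow: "y [^] (k::nat) \<in> ?A" if "y \<in> ?A" for y k using A that by (rule subgroup_pow_closed)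
  have Amult: "y \<otimes> w \<in> ?A" if "y \<in> ?A" "w \<in> ?A" for y w using subgroup.m_closed[OF A] that .
  have powmult: "(y \<otimes> w) [^] (k::nat) = y [^] k \<otimes> w [^] k" if "y \<in> ?A" "w \<in> ?A" for y w k
    using that AG bicentralizer_commute[OF xG] by (intro pow_mult_distrib) auto
  have dich: "maximal y" if "y \<in> ?A" "y \<notin> Z" "C y \<noteq> C x" for y
    using submax[of y] that unfolding bicentralizer_def by blast

  obtain na nb where six: "6 \<le> na * nb" and N: "N = card Z * (na * nb)"
    using N_factorization by metis
  have c: "c = card Z * (na * nb - 1)" using N by (simp add: diff_mult_distrib2)
  obtain d where d: "card ?A = d * N"
    using N_dvd_card_bicentralizer[OF x(1)] by (metis dvdE mult.commute)
  have "d \<noteq> 0"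
    using d card_Z_pos card_Z_le_card_bicentralizer[of x] by (intro notI) simp
  have "d \<noteq> 1"
    using d x(2) maximal_iff_card[OF x(1)] by auto
  have "card Z * (na * nb - 1) dvd d * (card Z * (na * nb)) - card Z"
    using c_dvd_card_bicentralizer[OF xG] d N c by simp
  moreover have "0 < na * nb" using six by linarith
  ultimately have "na * nb - 1 dvd d - 1"
    using card_Z_pos \<open>d \<noteq> 0\<close> by (intro pred_dvd_mult_pred[of "card Z"]) simp_all
  then have "na * nb - 1 \<le> d - 1" using \<open>d \<noteq> 0\<close> \<open>d \<noteq> 1\<close> by (intro dvd_imp_le) auto
  then have "6 \<le> d" using six by linarith
  then have "6 * N \<le> card ?A" unfolding d by (rule mult_le_mono1)
  then have big: "6 * c < card ?A" "card Z + 2 * c < card ?A" using card_Z_pos by simp_all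

  obtain y0 where y0: "maximal y0" "y0 \<in> ?A" using ex_maximal[OF x(1)] by blast
  \<comment> \<open>The center and two classes are too small to fill \<open>?A\<close>, so at least
    two different maximal centralizers occur.\<close>
  have "\<exists>y1 \<in> ?A - Z. C y1 \<noteq> C x \<and> C y1 \<noteq> C y0"
  proof (rule ccontr)
    assume "\<not> ?thesis"
    then have "?A \<subseteq> Z \<union> ?K \<union> {y \<in> carrier G. C y = C y0}" using AG by blast
    then have "card ?A \<le> card (Z \<union> ?K \<union> {y \<in> carrier G. C y = C y0})"
      using finite_Z finite_carrier by (intro card_mono) auto
    also have "\<dots> \<le> card Z + card ?K + card {y \<in> carrier G. C y = C y0}"
      by (meson add_le_mono1 card_Un_le order_trans)
    finally show False
      using big class_card[OF x(1)] class_card[OF maximal_mem[OF y0(1)]] by simp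
  qed
  then obtain y1 where y1: "maximal y1" "y1 \<in> ?A" "C y1 \<noteq> C y0" using dich by blast
  obtain u where u: "u \<in> bicentralizer y0 - Z" "u [^] a = \<one>"
    using maximal_has_torsion[OF y0(1)] by blast
  obtain v0 where v0: "v0 \<in> bicentralizer y0 - Z" "v0 [^] b = \<one>"
    using sw.maximal_has_torsion[OF y0(1)] by blast
  obtain v1 where v1: "v1 \<in> bicentralizer y1 - Z" "v1 [^] b = \<one>"
    using sw.maximal_has_torsion[OF y1(1)] by blast
  have uA: "u \<in> ?A" and v0A: "v0 \<in> ?A" and v1A: "v1 \<in> ?A"
    using u v0 v1 y0 y1 bicentralizer_mono by blast+
  have neq: "C v0 \<noteq> C v1"
    using maximal_eq[OF y0(1) v0(1)] maximal_eq[OF y1(1) v1(1)] y1(3) by simp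

  define S where "S = {\<one>, v0, v1, u, u \<otimes> v0, u \<otimes> v1}"
  have S: "S \<subseteq> ?A" using uA v0A v1A Amult subgroup.one_closed[OF A] by (auto simp: S_def)
  \<comment> \<open>The translate is built in two moves. A factor \<open>u\<close> makes the
    \<open>e\<close>-part noncentral if necessary. If that part has centralizer \<open>C x\<close>,
    the class is already reached. Otherwise it is maximal, and a factor \<open>v0\<close> or
    \<open>v1\<close> pushes the \<open>f\<close>-part out of its bicentralizer, if necessary,
    without changing the \<open>e\<close>-part; the result is neither central nor maximal.\<close>
  have shift: "\<exists>s\<in>S. g \<otimes> s \<in> ?K" if g: "g \<in> ?A" for g
  proof -
    obtain s1 where s1: "s1 = \<one> \<or> s1 = u" and s1e: "(g \<otimes> s1) [^] e \<notin> Z"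
    proof (cases "g [^] e \<in> Z")
      case True
      have "(g \<otimes> u) [^] e = g [^] e \<otimes> u"
        using powmult[OF g uA] pow_e_of_torsion u(2) AG[OF uA] by simp
      moreover have "g [^] e \<otimes> u \<notin> Z"
        using subgroup_mult_notin[OF subgroup_group_center True AG[OF uA]] u(1) by simp
      ultimately show ?thesis using that[of u] by simp
    next
      case False
      then show ?thesis using that[of \<one>] AG[OF g] by simp
    qed
    define h where "h = g \<otimes> s1"
    have s1A: "s1 \<in> ?A" using s1 uA subgroup.one_closed[OF A] by auto
    have h: "h \<in> ?A" using g s1A Amult by (simp add: h_def)
    have he: "h [^] e \<notin> Z" using s1e by (simp add: h_def)
    show ?thesis
    proof (cases "C (h [^] e) = C x")
      case True
      then have "h \<in> ?K"
        using h centralizer_subset_pow[OF AG[OF h], of e] unfolding bicentralizer_def by auto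
      then show ?thesis using s1 unfolding h_def S_def by blast
    next
      case False
      let ?B = "bicentralizer (h [^] e)"
      have B: "subgroup ?B G" using AG[OF Apow[OF h]] by (rule subgroup_bicentralizer)
      have "maximal (h [^] e)" using dich[OF Apow[OF h] he False] .
      \<comment> \<open>If both were in \<open>?B\<close>, both would share the centralizer of
        \<open>h [^] e\<close>, against \<open>neq\<close>.\<close>
      then have "\<not> (v0 \<in> ?B \<and> v1 \<in> ?B)"
        using maximal_eq[of "h [^] e" v0] maximal_eq[of "h [^] e" v1] v0(1) v1(1) neq by auto
      then obtain v where v: "v = v0 \<or> v = v1" "v \<notin> ?B" by blast
      have vA: "v \<in> ?A" and vb: "v [^] b = \<one>" using v v0A v1A v0(2) v1(2) by auto
      obtain s2 where s2: "s2 = \<one> \<or> s2 = v" and s2f: "(h \<otimes> s2) [^] f \<notin> ?B"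
      proof (cases "h [^] f \<in> ?B")
        case True
        have "(h \<otimes> v) [^] f = h [^] f \<otimes> v"
          using powmult[OF h vA] sw.pow_e_of_torsion vb AG[OF vA] by simp
        moreover have "h [^] f \<otimes> v \<notin> ?B"
          using B True AG[OF vA] v(2) by (rule subgroup_mult_notin)
        ultimately show ?thesis using that[of v] by simp
      next
        case False
        then show ?thesis using that[of \<one>] AG[OF h] by simp
      qed
      define k where "k = h \<otimes> s2"
      have s2A: "s2 \<in> ?A" using s2 vA subgroup.one_closed[OF A] by auto
      have k: "k \<in> ?A" using h s2A Amult by (simp add: k_def)
      have "s2 [^] e = \<one>" using s2 pow_e_of_cotorsion[OF AG[OF vA] vb] by auto
      then have ke: "k [^] e = h [^] e"
        using powmult[OF h s2A] AG[OF h] by (simp add: k_def)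
      have kf: "k [^] f \<notin> ?B" using s2f by (simp add: k_def)
      have "k \<notin> Z"
        using kf subgroup_pow_closed[OF subgroup_group_center] group_center_subset_bicentralizer
        by blast
      \<comment> \<open>For maximal \<open>k\<close> its noncentral power \<open>k [^] e\<close>
        would have the same centralizer, which would bring \<open>k [^] f\<close> into
        \<open>?B\<close>.\<close>
      moreover have "\<not> maximal k"
      proof
        assume "maximal k"
        moreover have "k [^] e \<in> bicentralizer k"
          using centralizer_subset_pow[OF AG[OF k]] AG[OF k] by (simp add: bicentralizer_def)
        then have "k [^] e \<in> bicentralizer k - Z" using ke he by simp
        ultimately have "C (k [^] e) = C k" by (rule maximal_eq)
        then have "k [^] f \<in> bicentralizer (k [^] e)"
          using centralizer_subset_pow[OF AG[OF k], of f] AG[OF k] by (simp add: bicentralizer_def)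
        then show False using kf ke by simp
      qed
      ultimately have "k \<in> ?K" using dich[OF k] AG[OF k] by blast
      moreover have "k = g \<otimes> (s1 \<otimes> s2)"
        using AG g s1A s2A by (simp add: k_def h_def m_assoc)
      moreover have "s1 \<otimes> s2 \<in> S"
        using s1 s2 v(1) AG uA v0A v1A by (auto simp: S_def)
      ultimately show ?thesis by blast
    qed
  qed
  \<comment> \<open>Right multiplication is injective, so each of the at most six covering sets has
    at most \<open>c\<close> elements.\<close>
  have "?A \<subseteq> (\<Union>s\<in>S. {g \<in> ?A. g \<otimes> s \<in> ?K})" using shift by blast
  then have "card ?A \<le> card (\<Union>s\<in>S. {g \<in> ?A. g \<otimes> s \<in> ?K})"
    using finite_bicentralizer by (intro card_mono) (auto simp: S_def)
  also have "\<dots> \<le> (\<Sum>s\<in>S. card {g \<in> ?A. g \<otimes> s \<in> ?K})"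
    by (rule card_UN_le) (simp add: S_def)
  also have "\<dots> \<le> (\<Sum>s\<in>S. c)"
  proof (rule sum_mono)
    fix s assume "s \<in> S"
    then have s: "s \<in> carrier G" using S AG by blast
    have "card {g \<in> ?A. g \<otimes> s \<in> ?K} \<le> card ?K"
    proof (rule card_inj_on_le)
      show "inj_on (\<lambda>g. g \<otimes> s) {g \<in> ?A. g \<otimes> s \<in> ?K}"
        using s AG by (auto intro!: inj_onI)
    qed (use finite_carrier in auto)
    then show "card {g \<in> ?A. g \<otimes> s \<in> ?K} \<le> c" using class_card[OF x(1)] by simp
  qed
  also have "\<dots> \<le> 6 * c"
    using card_length[of "[\<one>, v0, v1, u, u \<otimes> v0, u \<otimes> v1]"] by (simp add: S_def)
  finally show False using big by simp
qed

end

section \<open>Counting torsion elements\<close>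

context group
begin

lemma conj_notin_group_center:
  assumes "g \<in> carrier G" and "x \<in> carrier G - group_center G"
  shows "g \<otimes> x \<otimes> inv g \<notin> group_center G"
proof
  assume z: "g \<otimes> x \<otimes> inv g \<in> group_center G"
  then have "g \<otimes> x \<otimes> inv g \<otimes> g = g \<otimes> (g \<otimes> x \<otimes> inv g)"
    using assms(1) by (simp add: group_center_def)
  then have "g \<otimes> x = g \<otimes> (g \<otimes> x \<otimes> inv g)"
    using assms by (simp add: m_assoc)
  then have "x = g \<otimes> x \<otimes> inv g" using assms by simp
  then show False using z assms by simp
qed

lemma conj_pow:
  assumes "g \<in> carrier G" and "x \<in> carrier G"
  shows "(g \<otimes> x \<otimes> inv g) [^] (n::nat) = g \<otimes> x [^] n \<otimes> inv g"
proof (induction n)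
  case 0
  then show ?case using assms by simp
next
  case (Suc n)
  have "g \<otimes> x [^] n \<otimes> inv g \<otimes> (g \<otimes> x \<otimes> inv g) = g \<otimes> x [^] n \<otimes> (inv g \<otimes> g) \<otimes> x \<otimes> inv g"
    using assms by (simp only: m_assoc m_closed inv_closed nat_pow_closed)
  then show ?case using Suc assms by (simp add: m_assoc)
qed

text \<open>\<open>E\<close> is a union of conjugacy classes. By the orbit-stabilizer theorem each
  has \<open>m\<close> elements, because the stabilizer of \<open>x\<close> is its centralizer, of
  order \<open>k\<close>.\<close>

lemma card_conj_closed:
  assumes fin: "finite (carrier G)" and E: "E \<subseteq> carrier G"
    and conj: "\<And>g x. g \<in> carrier G \<Longrightarrow> x \<in> E \<Longrightarrow> g \<otimes> x \<otimes> inv g \<in> E"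
    and card_C: "\<And>x. x \<in> E \<Longrightarrow> card (centralizer G x) = k" and order: "order G = m * k"
  shows "m dvd card E"
proof -
  let ?\<phi> = "\<lambda>g. \<lambda>h \<in> carrier G. g \<otimes> h \<otimes> inv g"
  interpret act: group_action G "carrier G" ?\<phi> by (rule action_by_conjugation)
  have orbit_eq: "orbit G ?\<phi> x = {g \<otimes> x \<otimes> inv g | g. g \<in> carrier G}" if "x \<in> carrier G" for x
    using that by (simp add: orbit_def)
  have "card {y \<in> E. orbit G ?\<phi> y = orbit G ?\<phi> x} = m" if x: "x \<in> E" for x
  proof -
    have xG: "x \<in> carrier G" using x E by blast
    have "{y \<in> E. orbit G ?\<phi> y = orbit G ?\<phi> x} = orbit G ?\<phi> x"
    proof (intro equalityI subsetI)
      fix y assume "y \<in> {y \<in> E. orbit G ?\<phi> y = orbit G ?\<phi> x}"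
      then show "y \<in> orbit G ?\<phi> x" using act.orbit_refl[of y] E by auto
    next
      fix y assume y: "y \<in> orbit G ?\<phi> x"
      then have yE: "y \<in> E" using conj[OF _ x] orbit_eq[OF xG] by auto
      then have yG: "y \<in> carrier G" using E by blast
      have xy: "x \<in> orbit G ?\<phi> y" using act.orbit_sym[OF xG yG y] .
      have "orbit G ?\<phi> y = orbit G ?\<phi> x"
      proof (intro equalityI subsetI)
        fix w assume w: "w \<in> orbit G ?\<phi> y"
        then have "w \<in> carrier G" using orbit_eq[OF yG] yG by auto
        then show "w \<in> orbit G ?\<phi> x" using act.orbit_trans[OF xG yG _ y w] by simp
      next
        fix w assume w: "w \<in> orbit G ?\<phi> x"
        then have "w \<in> carrier G" using orbit_eq[OF xG] xG by auto
        then show "w \<in> orbit G ?\<phi> y" using act.orbit_trans[OF yG xG _ xy w] by simp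
      qed
      then show "y \<in> {y \<in> E. orbit G ?\<phi> y = orbit G ?\<phi> x}" using yE by simp
    qed
    moreover have "stabilizer G ?\<phi> x = centralizer G x"
    proof -
      have "g \<otimes> x \<otimes> inv g = x \<longleftrightarrow> x \<otimes> g = g \<otimes> x" if g: "g \<in> carrier G" for g
        using g xG by (metis inv_solve_right m_closed)
      then show ?thesis
        using xG unfolding stabilizer_def centralizer_def by auto
    qed
    ultimately have "card {y \<in> E. orbit G ?\<phi> y = orbit G ?\<phi> x} * k = m * k"
      using act.orbit_stabilizer_theorem[OF xG] card_C[OF x] order by simp
    moreover have "k \<noteq> 0"
      using order fin order_gt_0_iff_finite by auto
    ultimately show ?thesis by simp
  qed
  then have "card E = m * card (orbit G ?\<phi> ` E)"
    using fin E by (intro card_eq_mult_image) (auto intro: finite_subset)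
  then show ?thesis by simp
qed

end

section \<open>Abelian centralizers and the final count\<close>

context regular_split
begin

text \<open>A noncentral \<open>g\<close> commuting with \<open>h\<close> has a noncentral part.
  Multiplying that part by an element of complementary torsion from the class of \<open>h\<close>
  gives a \<open>w\<close> through which \<open>C g\<close> and \<open>C h\<close> are seen to be
  equal. Hence noncentral centralizers are abelian.\<close>

lemma centralizer_eq_bicentralizer:
  assumes h: "h \<in> carrier G - Z"
  shows "C h = bicentralizer h"
proof
  interpret sw: regular_split G b a f e c by (rule regular_swap)
  have hG: "h \<in> carrier G" using h by simp
  show "bicentralizer h \<subseteq> C h" using hG by (rule bicentralizer_subset_centralizer)
  have max: "C y = C x" if "x \<in> carrier G - Z" "y \<in> carrier G - Z" "C x \<subseteq> C y" for x y
    using all_maximal[OF that(1)] that unfolding maximal_def by blast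
  obtain u where u: "u \<in> bicentralizer h - Z" "u [^] a = \<one>"
    using maximal_has_torsion[OF all_maximal[OF h]] by blast
  obtain v where v: "v \<in> bicentralizer h - Z" "v [^] b = \<one>"
    using sw.maximal_has_torsion[OF all_maximal[OF h]] by blast
  have uG: "u \<in> carrier G" and vG: "v \<in> carrier G"
    using u v bicentralizer_mem_carrier by blast+
  have Cu: "C u = C h" and Cv: "C v = C h"
    using maximal_eq[OF all_maximal[OF h]] u v by blast+
  \<comment> \<open>A product of commuting parts of coprime orders has both parts as powers, so by
    incomparability of centralizers all three have the same centralizer.\<close>
  have key: "C w = C (w [^] i)"
    if "w \<in> carrier G" "w [^] i \<notin> Z" for w and i :: nat
    using that max[of w "w [^] i"] centralizer_subset_pow[of w i]
      subgroup_pow_closed[OF subgroup_group_center] by blast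
  show "C h \<subseteq> bicentralizer h"
  proof
    fix g assume g: "g \<in> C h"
    then have gG: "g \<in> carrier G" by (simp add: centralizer_def)
    show "g \<in> bicentralizer h"
    proof (cases "g \<in> Z")
      case True
      then show ?thesis using group_center_subset_bicentralizer by blast
    next
      case False
      have pow_comm: "g [^] i \<otimes> w = w \<otimes> g [^] i" if "C w = C h" "w \<in> carrier G" for i :: nat and w
      proof (rule group_commutes_pow)
        have "g \<in> C w" using g that by simp
        then show "g \<otimes> w = w \<otimes> g" by (simp add: centralizer_def)
      qed (use gG that in auto)
      have "g [^] e \<notin> Z \<or> g [^] f \<notin> Z"
        using False pow_e_mult_pow_f[OF gG] subgroup.m_closed[OF subgroup_group_center] by metis
      then have "C g = C h"
      proof
        assume ge: "g [^] e \<notin> Z"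
        define w where "w = g [^] e \<otimes> v"
        have w: "w \<in> carrier G" using gG vG by (simp add: w_def)
        have pow: "w [^] (i::nat) = (g [^] e) [^] i \<otimes> v [^] i" for i
          unfolding w_def using pow_comm[OF Cv vG] gG vG by (intro pow_mult_distrib) auto
        have "w [^] e = g [^] e"
          using pow[of e] pow_e_of_torsion[OF _ pow_e_torsion[OF gG]]
            pow_e_of_cotorsion[OF vG v(2)] gG by simp
        moreover have "w [^] f = v"
          using pow[of f] sw.pow_e_of_cotorsion[OF _ pow_e_torsion[OF gG]]
            sw.pow_e_of_torsion[OF vG v(2)] gG vG by simp
        ultimately show "C g = C h"
          using key[OF gG ge] key[OF w, of e] key[OF w, of f] ge v(1) Cv by simp
      next
        assume gf: "g [^] f \<notin> Z"
        define w where "w = g [^] f \<otimes> u"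
        have w: "w \<in> carrier G" using gG uG by (simp add: w_def)
        have pow: "w [^] (i::nat) = (g [^] f) [^] i \<otimes> u [^] i" for i
          unfolding w_def using pow_comm[OF Cu uG] gG uG by (intro pow_mult_distrib) auto
        have "w [^] f = g [^] f"
          using pow[of f] sw.pow_e_of_torsion[OF _ sw.pow_e_torsion[OF gG]]
            sw.pow_e_of_cotorsion[OF uG u(2)] gG by simp
        moreover have "w [^] e = u"
          using pow[of e] pow_e_of_cotorsion[OF _ sw.pow_e_torsion[OF gG]]
            pow_e_of_torsion[OF uG u(2)] gG uG by simp
        ultimately show "C g = C h"
          using key[OF gG gf] key[OF w, of e] key[OF w, of f] gf u(1) Cu by simp
      qed
      then show ?thesis using gG by (simp add: bicentralizer_def)
    qed
  qed
qed

lemma card_centralizer: "h \<in> carrier G - Z \<Longrightarrow> card (C h) = N"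
  using centralizer_eq_bicentralizer all_maximal maximal_iff_card by metis

text \<open>The noncentral elements of order dividing \<open>a\<close> form a union of conjugacy
  classes of size \<open>m\<close>. They also meet every class of equal centralizers, namely in the
  torsion of a bicentralizer minus that of the center, whence the first factor.\<close>

lemma class_number_dvd:
  assumes m: "order G = m * N"
  shows "m dvd (gcd N a - gcd (card Z) a) * card (C ` (carrier G - Z))"
proof -
  let ?E = "{g \<in> carrier G - Z. g [^] a = \<one>}"
  have "card ?E = (gcd N a - gcd (card Z) a) * card (C ` ?E)"
  proof (rule card_eq_mult_image)
    show "finite ?E" using finite_carrier by simp
    fix x assume "x \<in> ?E"
    then have x: "x \<in> carrier G - Z" by simp
    have "{y \<in> ?E. C y = C x} = {h \<in> bicentralizer x. h [^] a = \<one>} - {h \<in> Z. h [^] a = \<one>}"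
      using all_maximal[OF x] maximal_eq[of x] unfolding bicentralizer_def by blast
    also have "card \<dots> = gcd N a - gcd (card Z) a"
      using card_torsion_bicentralizer[OF all_maximal[OF x]] card_torsion_center finite_Z
        group_center_subset_bicentralizer[of x] by (subst card_Diff_subset) auto
    finally show "card {y \<in> ?E. C y = C x} = gcd N a - gcd (card Z) a" .
  qed
  moreover have "C ` ?E = C ` (carrier G - Z)"
  proof (intro equalityI subsetI)
    fix K assume "K \<in> C ` (carrier G - Z)"
    then obtain x where x: "x \<in> carrier G - Z" "K = C x" by blast
    obtain u where u: "u \<in> bicentralizer x - Z" "u [^] a = \<one>"
      using maximal_has_torsion[OF all_maximal[OF x(1)]] by blast
    moreover have "C u = C x" using maximal_eq[OF all_maximal[OF x(1)] u(1)] .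
    ultimately show "K \<in> C ` ?E" using x bicentralizer_mem_carrier by blast
  qed auto
  moreover have "m dvd card ?E"
  proof (rule card_conj_closed[OF finite_carrier _ _ _ m])
    fix g x assume gx: "g \<in> carrier G" "x \<in> ?E"
    then show "g \<otimes> x \<otimes> inv g \<in> ?E" using conj_notin_group_center conj_pow by simp
  qed (use card_centralizer in auto)
  ultimately show ?thesis by simp
qed

lemma impossible: False
proof -
  interpret sw: regular_split G b a f e c by (rule regular_swap)
  obtain h where h: "h \<in> carrier G - Z" using ex_noncentral_a by blast
  obtain m where m: "order G = m * N"
    using lagrange[OF subgroup_centralizer] card_centralizer[OF h] h by (metis DiffD1)
  have "m \<noteq> 0" using m finite_carrier order_gt_0_iff_finite by auto
  have "m \<noteq> 1"
  proof
    assume "m = 1"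
    then have "C h = carrier G"
      using m card_centralizer[OF h] finite_carrier
      by (intro card_subset_eq) (auto simp: order_def centralizer_def)
    then show False using h mem_group_center_iff by blast
  qed
  let ?t = "card (C ` (carrier G - Z))"
  obtain na nb where na: "gcd N a = gcd (card Z) a * na" and nb: "gcd N b = gcd (card Z) b * nb"
    and two: "2 \<le> na" "2 \<le> nb" and "6 \<le> na * nb" and N: "N = card Z * (na * nb)"
    by (rule N_factorization)
  let ?n = "na * nb"
  have c: "c = card Z * (?n - 1)" using N by (simp add: diff_mult_distrib2)
  have "card (carrier G - Z) = c * ?t"
    using mem_group_center_iff by (intro card_eq_c_mult_card_image) auto
  moreover have "card (carrier G - Z) = m * (card Z * ?n) - card Z"
    using m N finite_Z subgroup.subset[OF subgroup_group_center]
    by (simp add: card_Diff_subset order_def)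
  \<comment> \<open>Two counts of the noncentral elements: by the group order, and by
    classes.\<close>
  ultimately have t: "m * (card Z * ?n) - card Z = card Z * (?n - 1) * ?t" using c by simp
  have "?n - 1 dvd m - 1"
  proof (rule pred_dvd_mult_pred[OF card_Z_pos])
    show "card Z * (?n - 1) dvd m * (card Z * ?n) - card Z" using t by (metis dvd_triv_left)
  qed (use \<open>m \<noteq> 0\<close> two in auto)
  then have "?n - 1 \<le> m - 1" using \<open>m \<noteq> 0\<close> \<open>m \<noteq> 1\<close> by (intro dvd_imp_le) auto
  then have n_le: "?n \<le> m" using \<open>m \<noteq> 0\<close> by linarith
  have "card Z * (m * ?n - 1) = m * (card Z * ?n) - card Z"
    by (simp add: diff_mult_distrib2 ac_simps)
  then have "card Z * (m * ?n - 1) = card Z * ((?n - 1) * ?t)"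
    using t by (simp only: mult.assoc)
  then have "m * ?n - 1 = (?n - 1) * ?t" using card_Z_pos by simp
  moreover have "1 \<le> m * ?n" using \<open>m \<noteq> 0\<close> two by simp
  ultimately have tm: "m * ?n = (?n - 1) * ?t + 1" by linarith
  \<comment> \<open>A common divisor of \<open>m\<close> and \<open>?t\<close> divides both products
    in \<open>tm\<close>, which differ by 1.\<close>
  have cop: "coprime m ?t"
  proof (rule coprimeI)
    fix q assume "q dvd m" "q dvd ?t"
    then have "q dvd m * ?n" "q dvd (?n - 1) * ?t" by simp_all
    then show "is_unit q" using tm by (metis dvd_add_right_iff)
  qed
  \<comment> \<open>Coprimality cancels \<open>?t\<close> from the torsion counts.\<close>
  have dvd_a: "m dvd gcd (card Z) a * (na - 1)"
    using class_number_dvd[OF m] cop na by (simp add: coprime_dvd_mult_left_iff diff_mult_distrib2)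
  have dvd_b: "m dvd gcd (card Z) b * (nb - 1)"
    using sw.class_number_dvd[OF m] cop nb by (simp add: coprime_dvd_mult_left_iff diff_mult_distrib2)
  \<comment> \<open>The \<open>b\<close>-part of \<open>m\<close> is coprime to the
    \<open>a\<close>-part of the order of the center, so it must divide \<open>na - 1\<close>;
    likewise with the roles exchanged.\<close>
  have "coprime (gcd m b) (gcd (card Z) a)" "coprime (gcd m a) (gcd (card Z) b)"
    using coprime_ab by (meson coprime_commute coprime_divisors gcd_dvd2)+
  moreover have "gcd m b dvd gcd (card Z) a * (na - 1)" "gcd m a dvd gcd (card Z) b * (nb - 1)"
    using dvd_a dvd_b by (meson dvd_trans gcd_dvd1)+
  ultimately have "gcd m b dvd na - 1" "gcd m a dvd nb - 1"
    by (simp_all add: coprime_dvd_mult_right_iff)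
  then have "gcd m b \<le> na - 1" "gcd m a \<le> nb - 1"
    using two by (auto intro!: dvd_imp_le)
  then have "gcd m b * gcd m a \<le> (na - 1) * (nb - 1)" by (rule mult_le_mono)
  \<comment> \<open>As \<open>m\<close> divides \<open>a * b\<close>, it divides the product of its
    two parts, so \<open>m\<close> is at most \<open>(na - 1) * (nb - 1)\<close>, against
    \<open>n_le\<close>.\<close>
  moreover have "m dvd gcd m b * gcd m a"
  proof -
    have "m dvd a * b" using m order_eq by (metis dvd_triv_left)
    then obtain i j where "m = i * j" "i dvd a" "j dvd b" using division_decomp by blast
    then have "j * i dvd gcd m b * gcd m a" by (intro mult_dvd_mono) auto
    then show ?thesis using \<open>m = i * j\<close> by (simp add: mult.commute)
  qed
  then have "m \<le> gcd m b * gcd m a" using \<open>m \<noteq> 0\<close> by (intro dvd_imp_le) auto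
  moreover have "(na - 1) * (nb - 1) < na * nb"
    using two by (intro mult_strict_mono) auto
  ultimately show False using n_le by linarith
qed

end

section \<open>The prime dividing the index of the center\<close>

context group
begin

text \<open>If a Sylow \<open>p\<close>-subgroup lay in the center, then, as \<open>p\<close> also
  divides the index, a power of \<open>p\<close> beyond the exact multiplicity would divide
  \<open>order G\<close>.\<close>

lemma ex_noncentral_prime_power_torsion:
  assumes fin: "finite (carrier G)" and p: "Factorial_Ring.prime p"
    and dvd: "p dvd card (rcosets group_center G)"
  shows "\<exists>x \<in> carrier G - group_center G. x [^] (p ^ multiplicity p (order G)) = \<one>"
proof -
  let ?j = "multiplicity p (order G)"
  have order_pos: "order G \<noteq> 0" using fin order_gt_0_iff_finite by auto
  have "order G = p ^ ?j * (order G div p ^ ?j)" by (simp add: multiplicity_dvd)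
  then obtain H where H: "subgroup H G" "card H = p ^ ?j"
    using sylow_thm[OF p is_group _ fin] by blast
  have "\<not> H \<subseteq> group_center G"
  proof
    assume "H \<subseteq> group_center G"
    then have "card H dvd card (group_center G)"
      using card_subgroup_dvd_card_subgroup H(1) subgroup_group_center by blast
    then have "p * p ^ ?j dvd order G"
      using mult_dvd_mono[OF dvd] H(2) lagrange[OF subgroup_group_center] by metis
    then have "Suc ?j \<le> ?j"
      using order_pos p by (intro multiplicity_geI) auto
    then show False by simp
  qed
  then obtain x where "x \<in> H" "x \<notin> group_center G" by blast
  then show ?thesis
    using pow_card_subgroup[OF H(1)] H subgroup.subset by fastforce
qed

text \<open>The noncentral elements not adjacent to \<open>u\<close> are those with the same
  centralizer, \<open>u\<close> included, so the degree is the number of noncentral elements minus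
  the class size.\<close>

lemma induced_regular_class_card:
  assumes fin: "finite (carrier G)" and reg: "induced_regular G"
    and x: "x \<in> carrier G - group_center G" and y: "y \<in> carrier G - group_center G"
  shows "card {w \<in> carrier G. centralizer G w = centralizer G x} =
    card {w \<in> carrier G. centralizer G w = centralizer G y}"
proof -
  let ?S = "carrier G - group_center G"
  have deg: "induced_nc_degree G u = card ?S - card {w \<in> carrier G. centralizer G w = centralizer G u}
      \<and> card {w \<in> carrier G. centralizer G w = centralizer G u} \<le> card ?S"
    if u: "u \<in> ?S" for u
  proof -
    have sub: "{w \<in> carrier G. centralizer G w = centralizer G u} \<subseteq> ?S"
      using u mem_group_center_iff by auto
    have "{w \<in> ?S. noncentralizer_adj G u w} =
        ?S - {w \<in> carrier G. centralizer G w = centralizer G u}"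
      unfolding noncentralizer_adj_def by auto
    then show ?thesis
      using sub fin card_mono[OF _ sub] unfolding induced_nc_degree_def
      by (simp add: card_Diff_subset)
  qed
  have "induced_nc_degree G x = induced_nc_degree G y"
    using reg x y unfolding induced_regular_def by blast
  then show ?thesis using deg[OF x] deg[OF y] by linarith
qed

text \<open>For distinct primes, splitting the order into its \<open>p\<close>-part and the
  cofactor, which contains the full \<open>q\<close>-part, instantiates the contradictory locale
  \<open>regular_split\<close>.\<close>

lemma induced_regular_prime_unique:
  assumes fin: "finite (carrier G)" and reg: "induced_regular G"
    and p: "Factorial_Ring.prime p" "p dvd card (rcosets group_center G)"
    and q: "Factorial_Ring.prime q" "q dvd card (rcosets group_center G)"
  shows "p = q"
proof (rule ccontr)
  assume neq: "p \<noteq> q"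
  define a where "a = p ^ multiplicity p (order G)"
  obtain b where order: "order G = a * b"
    unfolding a_def by (meson dvdE multiplicity_dvd)
  have "order G \<noteq> 0" using fin order_gt_0_iff_finite by auto
  then have "\<not> p dvd b"
    using p(1) order unfolding a_def
    by (metis dvd_mult_div_cancel multiplicity_decompose nonzero_mult_div_cancel_left
        not_prime_unit mult_eq_0_iff)
  then have cop: "coprime a b"
    unfolding a_def using p(1) by (simp add: prime_imp_coprime)
  have "coprime (q ^ multiplicity q (order G)) a"
    unfolding a_def using p(1) q(1) neq by (simp add: primes_coprime)
  moreover have "q ^ multiplicity q (order G) dvd a * b"
    unfolding order[symmetric] by (rule multiplicity_dvd)
  ultimately have qb: "q ^ multiplicity q (order G) dvd b"
    by (simp add: coprime_dvd_mult_right_iff)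
  obtain x where x: "x \<in> carrier G - group_center G" "x [^] a = \<one>"
    using ex_noncentral_prime_power_torsion[OF fin p] unfolding a_def by blast
  obtain y where y: "y \<in> carrier G - group_center G" "y [^] (q ^ multiplicity q (order G)) = \<one>"
    using ex_noncentral_prime_power_torsion[OF fin q] by blast
  then have yb: "y [^] b = \<one>"
    using qb pow_eq_id dvd_trans by (metis DiffD1)
  obtain e where e: "[e = 1] (mod a)" "[e = 0] (mod b)"
    using binary_chinese_remainder_nat[OF cop] by blast
  obtain f where f: "[f = 0] (mod a)" "[f = 1] (mod b)"
    using binary_chinese_remainder_nat[OF cop] by blast
  interpret regular_split G a b e f "card {w \<in> carrier G. centralizer G w = centralizer G x}"
  proof
    show "card {w \<in> carrier G. centralizer G w = centralizer G u} =
        card {w \<in> carrier G. centralizer G w = centralizer G x}"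
      if "u \<in> carrier G - group_center G" for u
      using induced_regular_class_card[OF fin reg that x(1)] .
  qed (use fin order cop e f x y yb in \<open>auto simp: cong_0_iff\<close>)
  show False by (rule impossible)
qed

end

theorem theorem3p5:
  fixes G (structure)
  assumes "group G"
    and "finite (carrier G)"
    and "\<not> comm_group G"
    and "induced_regular G"
  shows "\<exists>p. is_p_group (G Mod group_center G) p"
proof -
  interpret group G by fact
  let ?k = "card (rcosets group_center G)"
  have "order G \<noteq> 0" using assms(2) order_gt_0_iff_finite by auto
  then have k: "?k \<noteq> 0" using lagrange[OF subgroup_group_center] by (metis mult_0)
  have mod: "order (G Mod group_center G) = ?k" "finite (carrier (G Mod group_center G))"
    using k by (auto simp: order_def FactGroup_def intro: card_ge_0_finite)
  obtain p where p: "Factorial_Ring.prime p" and only_p: "\<And>q. Factorial_Ring.prime q \<Longrightarrow> q dvd ?k \<Longrightarrow> q = p"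
  proof (cases "?k = 1")
    case True
    \<comment> \<open>No prime divides 1, so any prime serves; 2 is the default, with exponent
      0.\<close>
    then show ?thesis using that[OF two_is_prime_nat] not_prime_1 by (metis nat_dvd_1_iff_1)
  next
    case False
    then obtain p where "Factorial_Ring.prime p" "p dvd ?k" using prime_factor_nat by blast
    then show ?thesis using that[of p] induced_regular_prime_unique[OF assms(2,4)] by blast
  qed
  obtain r where r: "?k = p ^ multiplicity p ?k * r" "\<not> p dvd r"
    using multiplicity_decompose'[of ?k p] k p by (metis not_prime_unit)
  \<comment> \<open>A prime divisor of \<open>r\<close> divides \<open>?k\<close> and so equals
    \<open>p\<close>, which was split off completely.\<close>
  have "r = 1"
  proof (rule ccontr)
    assume "r \<noteq> 1"
    then obtain q where "Factorial_Ring.prime q" "q dvd r" using prime_factor_nat by blast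
    then show False using only_p[of q] r by (metis dvd_mult)
  qed
  then show ?thesis using p r mod unfolding is_p_group_def by (metis mult_1_right)
qed

end
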